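(* Let $\phi>0$ and $\lambda>0$, and let $T$ be a random variable following the inverse weighted Lindley distribution $\mathrm{IWL}(\phi,\lambda)$. Then $X=1/T$ follows the weighted Lindley distribution with parameters $\phi$ and $\lambda$.
   Context: For $\phi>0$, $\lambda>0$, the inverse weighted Lindley distribution $\mathrm{IWL}(\phi,\lambda)$ is the distribution on $(0,\infty)$ with probability density function $$f(t\mid\phi,\lambda)=\frac{\lambda^{\phi+1}}{(\phi+\lambda)\Gamma(\phi)}\,t^{-\phi-1}\left(1+\frac1t\right)e^{-\lambda/t},\qquad t>0.$$ The weighted Lindley distribution with parameters $\phi>0$, $\lambda>0$ is the distribution on $(0,\infty)$ with probability density function $$\frac{\lambda^{\phi+1}}{(\phi+\lambda)\Gamma(\phi)}\,x^{\phi-1}(1+x)e^{-\lambda x},\qquad x>0.$$ Here $\Gamma$ is the gamma function. *)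

theory Defs
  imports "HOL-Probability.Probability"
begin

(* Densities of distributions on the positive half-line, extended by 0 to the whole real
   line so that they are densities with respect to lborel. *)

definition inverse_weighted_lindley_density :: "real \<Rightarrow> real \<Rightarrow> real \<Rightarrow> real" where
  "inverse_weighted_lindley_density \<phi> l t =
     (if t > 0 then l powr (\<phi> + 1) / ((\<phi> + l) * Gamma \<phi>) * t powr (- \<phi> - 1)
                      * (1 + 1 / t) * exp (- l / t)
      else 0)"

definition weighted_lindley_density :: "real \<Rightarrow> real \<Rightarrow> real \<Rightarrow> real" where
  "weighted_lindley_density \<phi> l x =
     (if x > 0 then l powr (\<phi> + 1) / ((\<phi> + l) * Gamma \<phi>) * x powr (\<phi> - 1)
                      * (1 + x) * exp (- l * x)
      else 0)"

end

theory Submission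
  imports Defs
begin

text \<open>This is the change of variables \<open>t = 1 / x\<close> on the positive half-line, with
  Jacobian \<open>1 / x^2\<close>. If \<open>T\<close> has density \<open>f\<close> vanishing off
  the positive reals, then \<open>1 / T\<close> has density \<open>f (1 / x) / x^2\<close> there
  (\<open>distributed_reciprocal\<close>). The substitution is proved on compact intervals and
  extended to the half-line by exhaustion (\<open>nn_integral_reciprocal\<close>). What remains is
  algebra on the two Lindley densities (\<open>weighted_lindley_density_reciprocal\<close>).\<close>

lemma nn_integral_reciprocal_Icc:
  fixes f :: "real \<Rightarrow> ennreal" and a b :: real
  assumes [measurable]: "f \<in> borel_measurable borel" and "0 < a" "a < b"
  shows "(\<integral>\<^sup>+x. f x * indicator {1 / b..1 / a} x \<partial>lborel) =
         (\<integral>\<^sup>+x. f (1 / x) * ennreal (1 / x\<^sup>2) * indicator {a..b} x \<partial>lborel)"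
proof -
  \<comment> \<open>The substitution rule needs an increasing map, hence the detour through \<open>x \<mapsto> - (1 / x)\<close>.\<close>
  have "(\<integral>\<^sup>+x. f x * indicator {1 / b..1 / a} x \<partial>lborel) =
        (\<integral>\<^sup>+x. f (- x) * indicator {1 / b..1 / a} (- x) \<partial>lborel)"
    by (subst nn_integral_real_affine[where c = "-1" and t = 0]) simp_all
  also have "\<dots> = (\<integral>\<^sup>+x. f (- x) * indicator {- (1 / a)..- (1 / b)} x \<partial>lborel)"
    by (intro nn_integral_cong) (auto split: split_indicator)
  also have "\<dots> = (\<integral>\<^sup>+x. f (- (- (1 / x))) * ennreal (1 / x\<^sup>2) * indicator {a..b} x \<partial>lborel)"
  proof (rule nn_integral_substitution_aux[where f = "\<lambda>x. f (- x)" and g = "\<lambda>x. - (1 / x)"])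
    show "((\<lambda>x. - (1 / x)) has_real_derivative 1 / x\<^sup>2) (at x)" if "x \<in> {a..b}" for x
      using that \<open>0 < a\<close>
      by (auto intro!: derivative_eq_intros simp: power2_eq_square)
    show "continuous_on {a..b} (\<lambda>x. 1 / x\<^sup>2)"
      using \<open>0 < a\<close> by (auto intro!: continuous_intros)
  qed (use \<open>a < b\<close> in auto)
  finally show ?thesis by simp
qed

text \<open>Compact intervals increasing to the half-line carry the substitution over: both sides
  are measures with a density, hence continuous from below.\<close>

lemma nn_integral_reciprocal:
  fixes f :: "real \<Rightarrow> ennreal"
  assumes [measurable]: "f \<in> borel_measurable borel"
  shows "(\<integral>\<^sup>+x. f x * indicator {0<..} x \<partial>lborel) =
         (\<integral>\<^sup>+x. f (1 / x) * ennreal (1 / x\<^sup>2) * indicator {0<..} x \<partial>lborel)"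
proof -
  let ?g = "\<lambda>x. f (1 / x) * ennreal (1 / x\<^sup>2)"
  \<comment> \<open>Each \<open>A n\<close> is mapped onto itself by the reciprocal, so both
    integrals run over the same set. The shift by 2 makes even \<open>A 0\<close> a nondegenerate
    interval, as the compact case requires.\<close>
  define A :: "nat \<Rightarrow> real set" where "A n = {1 / (real n + 2)..real n + 2}" for n
  have incA: "incseq A"
    unfolding A_def by (intro incseq_SucI) (auto simp: field_simps)
  have UN: "(\<Union>n. A n) = {0<..}"
  proof (intro equalityI subsetI)
    fix x :: real
    assume "x \<in> (\<Union>n. A n)"
    then obtain n where "1 / (real n + 2) \<le> x" by (auto simp: A_def)
    moreover have "0 < 1 / (real n + 2)" by simp
    ultimately have "0 < x" by (rule less_le_trans[rotated])
    then show "x \<in> {0<..}" by simp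
  next
    fix x :: real
    assume "x \<in> {0<..}"
    then have x: "0 < x" by simp
    obtain n where n: "max x (1 / x) \<le> real n" using real_arch_simple by blast
    then have "1 / x \<le> real n + 2" by simp
    with x have "1 / (real n + 2) \<le> x" by (simp add: field_simps)
    with n show "x \<in> (\<Union>n. A n)" by (auto simp: A_def intro!: exI[of _ n])
  qed
  have eq: "emeasure (density lborel f) (A n) = emeasure (density lborel ?g) (A n)" for n
  proof -
    have "1 / (real n + 2) < real n + 2"
      by (rule less_trans[of _ 1]) simp_all
    then show ?thesis
      using nn_integral_reciprocal_Icc[OF assms, of "1 / (real n + 2)" "real n + 2"]
      by (simp add: A_def emeasure_density)
  qed
  have sets: "range A \<subseteq> sets (density lborel h)" for h
    by (auto simp: A_def)
  have "emeasure (density lborel f) {0<..} = emeasure (density lborel ?g) {0<..}"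
    using SUP_emeasure_incseq[OF sets incA, of f] SUP_emeasure_incseq[OF sets incA, of ?g] eq
    by (simp add: UN)
  then show ?thesis by (simp add: emeasure_density)
qed

text \<open>The law of \<open>1 / T\<close> is compared with \<open>density lborel g\<close> on each
  Borel set, by pulling the indicator back to an integral against \<open>f\<close>.\<close>

lemma distributed_reciprocal:
  fixes T :: "'a \<Rightarrow> real" and f g :: "real \<Rightarrow> ennreal"
  assumes T: "distributed M lborel T f"
    and f0: "\<And>t. t \<le> 0 \<Longrightarrow> f t = 0"
    and g0: "\<And>x. x \<le> 0 \<Longrightarrow> g x = 0"
    and g: "\<And>x. 0 < x \<Longrightarrow> g x = f (1 / x) * ennreal (1 / x\<^sup>2)"
  shows "distributed M lborel (\<lambda>\<omega>. 1 / T \<omega>) g"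
proof -
  have [measurable]: "f \<in> borel_measurable borel" "T \<in> borel_measurable M"
    using T by (auto simp: distributed_def)
  have g_eq: "g = (\<lambda>x. f (1 / x) * ennreal (1 / x\<^sup>2) * indicator {0<..} x)"
    using g0 g by (auto simp: fun_eq_iff split: split_indicator)
  have [measurable]: "g \<in> borel_measurable borel"
    unfolding g_eq by measurable
  have "distr M lborel (\<lambda>\<omega>. 1 / T \<omega>) = density lborel g"
  proof (rule measure_eqI)
    fix A :: "real set"
    assume "A \<in> sets (distr M lborel (\<lambda>\<omega>. 1 / T \<omega>))"
    then have [measurable]: "A \<in> sets borel" by simp
    have "emeasure (distr M lborel (\<lambda>\<omega>. 1 / T \<omega>)) A =
          (\<integral>\<^sup>+\<omega>. indicator A (1 / T \<omega>) \<partial>M)"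
      by (subst nn_integral_indicator[symmetric], simp, subst nn_integral_distr) simp_all
    also have "\<dots> = (\<integral>\<^sup>+t. f t * indicator A (1 / t) \<partial>lborel)"
      by (rule distributed_nn_integral[OF T, symmetric]) simp
    \<comment> \<open>Since \<open>f\<close> vanishes for \<open>t \<le> 0\<close>, the convention
      \<open>1 / 0 = 0\<close> has no effect on the integral.\<close>
    also have "\<dots> = (\<integral>\<^sup>+t. f t * indicator A (1 / t) * indicator {0<..} t \<partial>lborel)"
      using f0 by (intro nn_integral_cong) (auto split: split_indicator)
    also have "\<dots> = (\<integral>\<^sup>+x. f (1 / x) * indicator A (1 / (1 / x)) * ennreal (1 / x\<^sup>2)
                        * indicator {0<..} x \<partial>lborel)"
      by (rule nn_integral_reciprocal) simp
    also have "\<dots> = (\<integral>\<^sup>+x. g x * indicator A x \<partial>lborel)"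
      unfolding g_eq by (intro nn_integral_cong) (auto split: split_indicator)
    also have "\<dots> = emeasure (density lborel g) A"
      by (simp add: emeasure_density)
    finally show "emeasure (distr M lborel (\<lambda>\<omega>. 1 / T \<omega>)) A = emeasure (density lborel g) A" .
  qed simp
  then show ?thesis by (simp add: distributed_def)
qed

text \<open>The normalising constants coincide, \<open>1 + 1 / t\<close> and
  \<open>exp (- l / t)\<close> become \<open>1 + x\<close> and \<open>exp (- l * x)\<close>, and the
  Jacobian lowers the exponent of \<open>x\<close> from \<open>\<phi> + 1\<close> to
  \<open>\<phi> - 1\<close>.\<close>

lemma weighted_lindley_density_reciprocal:
  assumes "0 < x"
  shows "weighted_lindley_density \<phi> l x = inverse_weighted_lindley_density \<phi> l (1 / x) * (1 / x\<^sup>2)"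
proof -
  have "(1 / x) powr (- \<phi> - 1) * (1 / x\<^sup>2) = x powr (\<phi> + 1) * x powr (- 2)"
    using assms by (simp add: powr_divide powr_minus powr_diff powr_add field_simps)
  also have "\<dots> = x powr (\<phi> - 1)"
    by (simp flip: powr_add)
  finally have "x powr (\<phi> - 1) = (1 / x) powr (- \<phi> - 1) * (1 / x\<^sup>2)" by (rule sym)
  with assms show ?thesis
    by (simp add: weighted_lindley_density_def inverse_weighted_lindley_density_def)
qed

theorem proposition2p1:
  fixes M :: "'a measure" and T :: "'a \<Rightarrow> real" and \<phi> l :: real
  assumes "prob_space M"
    and "\<phi> > 0" and "l > 0"
    and "distributed M lborel T (\<lambda>t. ennreal (inverse_weighted_lindley_density \<phi> l t))"
  shows "distributed M lborel (\<lambda>\<omega>. 1 / T \<omega>) (\<lambda>x. ennreal (weighted_lindley_density \<phi> l x))"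
proof (rule distributed_reciprocal[OF assms(4)])
  fix x :: real
  assume "0 < x"
  then show "ennreal (weighted_lindley_density \<phi> l x) =
      ennreal (inverse_weighted_lindley_density \<phi> l (1 / x)) * ennreal (1 / x\<^sup>2)"
    \<comment> \<open>\<open>ennreal\<close> splits over this product because the factor
      \<open>1 / x^2\<close> is nonnegative.\<close>
    by (simp only: weighted_lindley_density_reciprocal) (simp flip: ennreal_mult'')
qed (simp_all add: weighted_lindley_density_def inverse_weighted_lindley_density_def)

end
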